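(* Let $(X,\|\cdot\|)$ be a real Banach space. Let $\{S(t)\}_{t\in[0,\infty)}$ be a closed m-semigroup on $X$ possessing the global attractor $\mathcal{A}$. Let $\kappa_0>0$ and, for each $k\in(0,\kappa_0]$, let $\{S_k^n\}_{n\in\mathbb{N}}$ be a closed discrete m-semigroup on $X$, generated by the iterates of a set-valued map $S_k:2^X\to2^X$, with global attractor $\mathcal{A}_k$. Assume the following. (1) There exists $\kappa_1\in(0,\kappa_0]$ such that the set $\mathcal{K}=\bigcup_{k\in(0,\kappa_1]}\mathcal{A}_k$ is bounded in $X$. (2) There exists $t_0\ge0$ such that for any $T^\star>t_0$, $$\lim_{k\to0}\ \sup_{x\in\mathcal{A}_k,\ n\in\mathbb{N},\ nk\in[t_0,T^\star]}\|S_k^nx-S(nk)x\|=0.$$ Then $$\lim_{k\to0}\operatorname{dist}(\mathcal{A}_k,\mathcal{A})=0.$$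
   Context: Let $\mathbb{T}$ be either $[0,\infty)$ or $\mathbb{N}=\{0,1,2,\dots\}$. An m-semigroup (multivalued semigroup) on $X$ is a family of set-valued maps $S(t):2^X\to2^X$, $t\in\mathbb{T}$, with $S(0)$ the identity on $2^X$ and $S(t+\tau)=S(t)S(\tau)$ for all $t,\tau\in\mathbb{T}$; one writes $S(t)x=S(t)\{x\}$ and assumes $S(t)\mathcal{B}=\bigcup_{x\in\mathcal{B}}S(t)x$ for every $\mathcal{B}\subset X$. The sets $S(t)x$ are nonempty. The m-semigroup is closed if, for every $t\in\mathbb{T}$, whenever $x_n\to x$, $y_n\in S(t)x_n$ and $y_n\to y$, one has $y\in S(t)x$. A discrete m-semigroup ($\mathbb{T}=\mathbb{N}$) generated by a set-valued map $S_k$ is $n\mapsto S_k^n$, the iterates of $S_k$, with $S_k^0$ the identity on $2^X$. For nonempty $\mathcal{B},\mathcal{C}\subset X$: $\operatorname{dist}(\mathcal{B},\mathcal{C})=\sup_{b\in\mathcal{B}}\inf_{c\in\mathcal{C}}\|b-c\|$ (Hausdorff semidistance), $\mathcal{B}-\mathcal{C}=\{b-c:\ b\in\mathcal{B},\ c\in\mathcal{C}\}$, and $\|\mathcal{B}\|=\sup_{b\in\mathcal{B}}\|b\|$. The global attractor of an m-semigroup $S(t)$ is the (necessarily unique) nonempty compact set $\mathcal{A}\subset X$ that is invariant, $S(t)\mathcal{A}=\mathcal{A}$ for all $t\in\mathbb{T}$, and attracting, $\lim_{t\to\infty}\operatorname{dist}(S(t)\mathcal{B},\mathcal{A})=0$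 for every (nonempty) bounded $\mathcal{B}\subset X$. *)

theory Defs
  imports "HOL-Analysis.Analysis"
begin

text \<open>
  The time type is meant to be instantiated to \<^typ>\<open>real\<close> or \<^typ>\<open>nat\<close>; the time set is
  the set of its nonnegative elements, i.e. \<open>[0, \<infinity>)\<close> and all of \<^typ>\<open>nat\<close>, respectively. The
  values at negative times play no role.
\<close>

definition m_semigroup :: "('t::linordered_semidom \<Rightarrow> 'a set \<Rightarrow> 'a set) \<Rightarrow> bool" where
  "m_semigroup S \<longleftrightarrow>
     S 0 = id \<and>
     (\<forall>t\<ge>0. \<forall>\<tau>\<ge>0. S (t + \<tau>) = S t \<circ> S \<tau>) \<and>
     (\<forall>t\<ge>0. \<forall>B. S t B = (\<Union>x\<in>B. S t {x})) \<and>
     (\<forall>t\<ge>0. \<forall>x. S t {x} \<noteq> {})"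

definition closed_m_semigroup ::
    "('t::linordered_semidom \<Rightarrow> 'a::topological_space set \<Rightarrow> 'a set) \<Rightarrow> bool" where
  "closed_m_semigroup S \<longleftrightarrow>
     m_semigroup S \<and>
     (\<forall>t\<ge>0. \<forall>(xs :: nat \<Rightarrow> 'a) x ys y.
        xs \<longlonglongrightarrow> x \<longrightarrow> (\<forall>n. ys n \<in> S t {xs n}) \<longrightarrow> ys \<longlonglongrightarrow> y \<longrightarrow> y \<in> S t {x})"

text \<open>
  Suprema are taken in \<^typ>\<open>ennreal\<close>, so that they are \<open>\<infinity>\<close> (and not a junk value) on
  unbounded sets.
\<close>

definition hausdorff_semidist :: "'a::real_normed_vector set \<Rightarrow> 'a set \<Rightarrow> ennreal" where
  "hausdorff_semidist B C = (SUP b\<in>B. INF c\<in>C. ennreal (norm (b - c)))"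

definition minkowski_diff :: "'a::real_normed_vector set \<Rightarrow> 'a set \<Rightarrow> 'a set" where
  "minkowski_diff B C = {b - c | b c. b \<in> B \<and> c \<in> C}"

definition set_norm :: "'a::real_normed_vector set \<Rightarrow> ennreal" where
  "set_norm B = (SUP b\<in>B. ennreal (norm b))"

definition global_attractor ::
    "('t::linordered_semidom \<Rightarrow> 'a::real_normed_vector set \<Rightarrow> 'a set) \<Rightarrow> 'a set \<Rightarrow> bool" where
  "global_attractor S A \<longleftrightarrow>
     A \<noteq> {} \<and> compact A \<and>
     (\<forall>t\<ge>0. S t A = A) \<and>
     (\<forall>B. B \<noteq> {} \<longrightarrow> bounded B \<longrightarrow> ((\<lambda>t. hausdorff_semidist (S t B) A) \<longlongrightarrow> 0) at_top)"

end

theory Submission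
  imports Defs
begin

text \<open>
  By invariance, every point of \<open>Ak k\<close> is reached from some \<open>x \<in> Ak k\<close> by \<open>n\<close> discrete steps, for
  a number of steps \<open>n\<close> that can be chosen freely. All the attractors \<open>Ak k\<close> with small \<open>k\<close> lie in
  one bounded set \<open>K\<close>, and \<open>A\<close> attracts \<open>K\<close> under \<open>S\<close>: from some time \<open>T \<ge> t\<^sub>0\<close> on, \<open>S t K\<close> is
  \<open>\<epsilon>\<close>-close to \<open>A\<close>, and \<open>T\<close> depends on \<open>K\<close> and \<open>\<epsilon>\<close> but not on \<open>k\<close>. For \<open>k \<le> 1\<close> some multiple
  \<open>n * k\<close> of the step size falls into the window \<open>[T, T + 1]\<close>. On this fixed window the discrete
  semigroup is uniformly \<open>\<epsilon>\<close>-close to \<open>S\<close> for small \<open>k\<close>, so the triangle inequality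
  (\<open>hausdorff_semidist_le_set_norm_diff\<close>) puts \<open>Ak k\<close> within \<open>2\<epsilon>\<close> of \<open>A\<close>.
\<close>

lemma m_semigroup_eq_UN:
  "m_semigroup S \<Longrightarrow> 0 \<le> t \<Longrightarrow> S t B = (\<Union>x\<in>B. S t {x})"
  unfolding m_semigroup_def by blast

lemma m_semigroup_nonempty:
  "m_semigroup S \<Longrightarrow> 0 \<le> t \<Longrightarrow> S t {x} \<noteq> {}"
  unfolding m_semigroup_def by blast

lemma global_attractor_invariant:
  "global_attractor S A \<Longrightarrow> 0 \<le> t \<Longrightarrow> S t A = A"
  unfolding global_attractor_def by blast

lemma hausdorff_semidist_mono:
  "B \<subseteq> C \<Longrightarrow> hausdorff_semidist B D \<le> hausdorff_semidist C D"
  unfolding hausdorff_semidist_def by (rule SUP_subset_mono) auto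

lemma hausdorff_semidist_UN:
  "hausdorff_semidist (\<Union>i\<in>I. B i) C = (SUP i\<in>I. hausdorff_semidist (B i) C)"
  unfolding hausdorff_semidist_def by (simp add: SUP_UNION)

text \<open>
  The norm of \<open>B - C\<close> bounds the distance from every point of \<open>B\<close> to every point of \<open>C\<close>, so any
  single point of \<open>C\<close> can serve as the intermediate point of a triangle inequality; this is why \<open>C\<close>
  has to be nonempty.
\<close>
lemma hausdorff_semidist_le_set_norm_diff:
  assumes "C \<noteq> {}"
  shows "hausdorff_semidist B D \<le> set_norm (minkowski_diff B C) + hausdorff_semidist C D"
proof -
  obtain c where c: "c \<in> C"
    using assms by auto
  have "(INF d\<in>D. ennreal (norm (b - d)))
      \<le> set_norm (minkowski_diff B C) + hausdorff_semidist C D" if b: "b \<in> B" for b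
  proof -
    \<comment> \<open>Moving the finite constant to the left by truncated subtraction lets the infimum over \<open>D\<close> be
      bounded termwise, also when \<open>D\<close> is empty and both infima are \<open>\<infinity>\<close>.\<close>
    have "(INF d\<in>D. ennreal (norm (b - d))) - ennreal (norm (b - c))
        \<le> (INF d\<in>D. ennreal (norm (c - d)))"
    proof (rule INF_greatest)
      fix d
      assume "d \<in> D"
      then have "(INF d\<in>D. ennreal (norm (b - d))) \<le> ennreal (norm (b - d))"
        by (rule INF_lower)
      also have "\<dots> \<le> ennreal (norm (b - c)) + ennreal (norm (c - d))"
        using norm_triangle_ineq[of "b - c" "c - d"] by (simp flip: ennreal_plus)
      finally show "(INF d\<in>D. ennreal (norm (b - d))) - ennreal (norm (b - c)) \<le> ennreal (norm (c - d))"
        unfolding ennreal_minus_le_iff by simp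
    qed
    then have "(INF d\<in>D. ennreal (norm (b - d)))
        \<le> ennreal (norm (b - c)) + (INF d\<in>D. ennreal (norm (c - d)))"
      unfolding ennreal_minus_le_iff by (rule conjunct1)
    also have "\<dots> \<le> set_norm (minkowski_diff B C) + hausdorff_semidist C D"
      unfolding set_norm_def hausdorff_semidist_def minkowski_diff_def
      using b c by (intro add_mono SUP_upper SUP_upper2[of "b - c"]) auto
    finally show ?thesis .
  qed
  then show ?thesis
    unfolding hausdorff_semidist_def[of B D] by (rule SUP_least)
qed

lemma ex_multiple_in_unit_window:
  fixes k T :: real
  assumes "0 < k" "k \<le> 1" "0 \<le> T"
  shows "\<exists>n::nat. real n * k \<in> {T..T + 1}"
proof -
  define n where "n = nat \<lceil>T / k\<rceil>"
  have "T / k \<le> real n"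
    unfolding n_def by (rule real_nat_ceiling_ge)
  moreover have "real n \<le> T / k + 1"
    using assms by (simp add: n_def)
  ultimately have "T \<le> real n * k" "real n * k \<le> T + k"
    using assms by (simp_all add: field_simps)
  then show ?thesis
    using assms by (intro exI[of _ n]) simp
qed

theorem theorem2p6:
  fixes S :: "real \<Rightarrow> 'a::banach set \<Rightarrow> 'a set"
    and A :: "'a set"
    and Sk :: "real \<Rightarrow> 'a set \<Rightarrow> 'a set"
    and Ak :: "real \<Rightarrow> 'a set"
    and \<kappa>\<^sub>0 :: real
  assumes S_closed: "closed_m_semigroup S"
    and S_attractor: "global_attractor S A"
    and \<kappa>0_pos: "\<kappa>\<^sub>0 > 0"
    and Sk_closed: "\<And>k. k \<in> {0<..\<kappa>\<^sub>0} \<Longrightarrow> closed_m_semigroup (\<lambda>n::nat. Sk k ^^ n)"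
    and Sk_attractor: "\<And>k. k \<in> {0<..\<kappa>\<^sub>0} \<Longrightarrow> global_attractor (\<lambda>n::nat. Sk k ^^ n) (Ak k)"
    and bounded_union: "\<exists>\<kappa>\<^sub>1\<in>{0<..\<kappa>\<^sub>0}. bounded (\<Union>k\<in>{0<..\<kappa>\<^sub>1}. Ak k)"
    and approximation:
      "\<exists>t\<^sub>0\<ge>0. \<forall>T>t\<^sub>0.
         ((\<lambda>k. SUP (x, n) \<in> {(x, n :: nat). x \<in> Ak k \<and> real n * k \<in> {t\<^sub>0..T}}.
                 set_norm (minkowski_diff ((Sk k ^^ n) {x}) (S (real n * k) {x})))
           \<longlongrightarrow> 0) (at_right 0)"
  shows "((\<lambda>k. hausdorff_semidist (Ak k) A) \<longlongrightarrow> 0) (at_right 0)"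
proof (rule order_tendstoI)
  have S_m_semigroup: "m_semigroup S"
    using S_closed unfolding closed_m_semigroup_def by (rule conjunct1)
  fix e :: ennreal
  assume "0 < e"
  then obtain d where d: "0 < d" "d < e"
    using dense by blast
  then obtain r where r: "0 < r" "ennreal r < e"
    by (cases d rule: ennreal_cases) auto
  define \<epsilon> where "\<epsilon> = ennreal (r / 2)"
  have \<epsilon>: "0 < \<epsilon>" "\<epsilon> + \<epsilon> < e"
    using r by (auto simp: \<epsilon>_def simp flip: ennreal_plus)
  obtain \<kappa>\<^sub>1 where \<kappa>1: "0 < \<kappa>\<^sub>1" "\<kappa>\<^sub>1 \<le> \<kappa>\<^sub>0" and bdd: "bounded (\<Union>k\<in>{0<..\<kappa>\<^sub>1}. Ak k)"
    using bounded_union by auto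
  define K where "K = (\<Union>k\<in>{0<..\<kappa>\<^sub>1}. Ak k)"
  obtain t\<^sub>0 where t0: "0 \<le> t\<^sub>0" and
    approx: "\<And>T. t\<^sub>0 < T \<Longrightarrow>
         ((\<lambda>k. SUP (x, n) \<in> {(x, n :: nat). x \<in> Ak k \<and> real n * k \<in> {t\<^sub>0..T}}.
                 set_norm (minkowski_diff ((Sk k ^^ n) {x}) (S (real n * k) {x})))
           \<longlongrightarrow> 0) (at_right 0)"
    using approximation by blast
  have "Ak \<kappa>\<^sub>1 \<noteq> {}"
    using Sk_attractor[of \<kappa>\<^sub>1] \<kappa>1 by (auto simp: global_attractor_def)
  then have "K \<noteq> {}"
    using \<kappa>1 by (auto simp: K_def)
  then have "((\<lambda>t. hausdorff_semidist (S t K) A) \<longlongrightarrow> 0) at_top"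
    using S_attractor bdd by (auto simp: global_attractor_def K_def)
  then obtain T' where T': "\<And>t. T' \<le> t \<Longrightarrow> hausdorff_semidist (S t K) A < \<epsilon>"
    using order_tendstoD(2)[OF _ \<epsilon>(1)] by (force simp: eventually_at_top_linorder)
  define T where "T = max t\<^sub>0 T'"
  have "0 \<le> T"
    using t0 by (simp add: T_def)
  have "eventually (\<lambda>k. (SUP (x, n) \<in> {(x, n :: nat). x \<in> Ak k \<and> real n * k \<in> {t\<^sub>0..T + 1}}.
      set_norm (minkowski_diff ((Sk k ^^ n) {x}) (S (real n * k) {x}))) < \<epsilon>) (at_right 0)"
    by (rule order_tendstoD(2)[OF approx \<epsilon>(1)]) (simp add: T_def)
  moreover have "eventually (\<lambda>k. k \<in> {0<..<min \<kappa>\<^sub>1 1}) (at_right 0)"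
    using \<kappa>1 by (intro eventually_at_right_real) simp
  ultimately show "eventually (\<lambda>k. hausdorff_semidist (Ak k) A < e) (at_right 0)"
  proof eventually_elim
    case (elim k)
    then have k: "0 < k" "k \<le> 1" "k \<le> \<kappa>\<^sub>1"
      by auto
    have Ak_sub: "Ak k \<subseteq> K"
      using k by (auto simp: K_def)
    obtain n :: nat where n: "real n * k \<in> {T..T + 1}"
      using ex_multiple_in_unit_window[of k T] k \<open>0 \<le> T\<close> by blast
    define t where "t = real n * k"
    have t: "0 \<le> t" "t\<^sub>0 \<le> t" "T' \<le> t" "t \<le> T + 1"
      using n t0 by (auto simp: t_def T_def)
    have "m_semigroup (\<lambda>n::nat. Sk k ^^ n)" "global_attractor (\<lambda>n::nat. Sk k ^^ n) (Ak k)"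
      using Sk_closed[of k, unfolded closed_m_semigroup_def] Sk_attractor[of k] k \<kappa>1 by auto
    note Sk_UN = m_semigroup_eq_UN[OF this(1), of n "Ak k", OF le0]
      and Ak_invariant = global_attractor_invariant[OF this(2), of n, OF le0]
    have Ak_eq: "Ak k = (\<Union>x\<in>Ak k. (Sk k ^^ n) {x})"
      by (rule trans[OF Ak_invariant[symmetric] Sk_UN])
    have "hausdorff_semidist ((Sk k ^^ n) {x}) A \<le> \<epsilon> + \<epsilon>" if x: "x \<in> Ak k" for x
    proof -
      have "set_norm (minkowski_diff ((Sk k ^^ n) {x}) (S t {x})) \<le> \<epsilon>"
        using x t(2,4)
        by (intro order_trans[OF _ less_imp_le[OF elim(1)]] SUP_upper2[of "(x, n)"])
           (auto simp: t_def)
      moreover have "S t {x} \<subseteq> S t K"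
        using m_semigroup_eq_UN[OF S_m_semigroup t(1), of K] x Ak_sub by blast
      then have "hausdorff_semidist (S t {x}) A \<le> \<epsilon>"
        using hausdorff_semidist_mono T'[OF t(3)] by (meson less_imp_le order_trans)
      ultimately show ?thesis
        using hausdorff_semidist_le_set_norm_diff[OF m_semigroup_nonempty[OF S_m_semigroup t(1)]]
        by (rule order_trans[rotated, OF add_mono])
    qed
    then have "(SUP x\<in>Ak k. hausdorff_semidist ((Sk k ^^ n) {x}) A) \<le> \<epsilon> + \<epsilon>"
      by (rule SUP_least)
    then have "hausdorff_semidist (Ak k) A \<le> \<epsilon> + \<epsilon>"
      by (subst Ak_eq) (simp only: hausdorff_semidist_UN)
    then show "hausdorff_semidist (Ak k) A < e"
      using \<epsilon>(2) by (rule le_less_trans)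
  qed
qed simp

end
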